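(* Let $a_0,\dots,a_N$ and $b_0,\dots,b_M$ be constants, and put $P_x(w)=\sum_{k=0}^{N}a_kw^k$ and $P_y(w)=\sum_{l=0}^{M}b_lw^l$, where $P_x(-n)\neq 0$ and $P_y(-n)\neq 0$ for every integer $n\ge 1$. Let $c(k,m)$, $k,m\ge 1$, be numbers and put $$G(x,y)=\sum_{k,m=1}^{\infty}\frac{c(k,m)}{(e^{kx}-1)(e^{my}-1)}\qquad (x,y>0).$$ Then the equation $$\sum_{k=0}^{N}\sum_{l=0}^{M}a_k b_l\,\frac{\partial^{k+l}u}{\partial x^k\,\partial y^l}(x,y)=G(x,y)$$ has solution $$u(x,y)=\sum_{n,m=1}^{\infty}\frac{S(n,m)}{(e^{nx}-1)(e^{my}-1)},$$ where $$S(n,m)=\sum_{d\mid n,\ \delta\mid m}B(d,\delta)\,\mu(n/d)\,\mu(m/\delta)$$ and $$B(n,m)=\frac{1}{P_x(-n)P_y(-m)}\sum_{k\mid n,\ r\mid m}c(k,r).$$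
   Context: $\mu$ denotes the Möbius function; sums over $d\mid n$, $\delta\mid m$, $k\mid n$, $r\mid m$ run over positive divisors. The subscripts $x,y$ in $P_x,P_y$ are only labels. *)

theory Defs
  imports "HOL-Analysis.Analysis" "HOL-Computational_Algebra.Squarefree"
begin

definition moebius_mu :: "nat \<Rightarrow> int" where
  "moebius_mu n = (if squarefree n then (-1) ^ card (prime_factors n) else 0)"

definition symbol_poly :: "nat \<Rightarrow> (nat \<Rightarrow> complex) \<Rightarrow> complex \<Rightarrow> complex" where
  "symbol_poly N a w = (\<Sum>k\<le>N. a k * w ^ k)"

definition lambert_term ::
    "(nat \<Rightarrow> nat \<Rightarrow> complex) \<Rightarrow> real \<Rightarrow> real \<Rightarrow> nat \<times> nat \<Rightarrow> complex" where
  "lambert_term c x y =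
     (\<lambda>(k, m). c k m / of_real ((exp (real k * x) - 1) * (exp (real m * y) - 1)))"

text \<open>Double series are unordered sums. As the values are complex numbers, summability
  means absolute convergence. The value of an unordered sum that does not converge is \<open>0\<close>,
  so summability has to be stated separately.\<close>

definition lambert_convergent :: "(nat \<Rightarrow> nat \<Rightarrow> complex) \<Rightarrow> bool" where
  "lambert_convergent c \<longleftrightarrow> (\<forall>x>0. \<forall>y>0. lambert_term c x y summable_on ({1..} \<times> {1..}))"

definition lambert_series :: "(nat \<Rightarrow> nat \<Rightarrow> complex) \<Rightarrow> real \<Rightarrow> real \<Rightarrow> complex" where
  "lambert_series c x y = (\<Sum>\<^sub>\<infinity>p\<in>{1..} \<times> {1..}. lambert_term c x y p)"

definition coeff_B :: "nat \<Rightarrow> (nat \<Rightarrow> complex) \<Rightarrow> nat \<Rightarrow> (nat \<Rightarrow> complex) \<Rightarrow>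
    (nat \<Rightarrow> nat \<Rightarrow> complex) \<Rightarrow> nat \<Rightarrow> nat \<Rightarrow> complex" where
  "coeff_B N a M b c n m =
     1 / (symbol_poly N a (- of_nat n) * symbol_poly M b (- of_nat m)) *
     (\<Sum>k | k dvd n. \<Sum>r | r dvd m. c k r)"

definition coeff_S :: "nat \<Rightarrow> (nat \<Rightarrow> complex) \<Rightarrow> nat \<Rightarrow> (nat \<Rightarrow> complex) \<Rightarrow>
    (nat \<Rightarrow> nat \<Rightarrow> complex) \<Rightarrow> nat \<Rightarrow> nat \<Rightarrow> complex" where
  "coeff_S N a M b c n m =
     (\<Sum>d | d dvd n. \<Sum>\<delta> | \<delta> dvd m.
        coeff_B N a M b c d \<delta> * of_int (moebius_mu (n div d)) * of_int (moebius_mu (m div \<delta>)))"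

definition partial_x :: "(real \<Rightarrow> real \<Rightarrow> complex) \<Rightarrow> real \<Rightarrow> real \<Rightarrow> complex" where
  "partial_x u x y = vector_derivative (\<lambda>t. u t y) (at x)"

definition partial_y :: "(real \<Rightarrow> real \<Rightarrow> complex) \<Rightarrow> real \<Rightarrow> real \<Rightarrow> complex" where
  "partial_y u x y = vector_derivative (\<lambda>t. u x t) (at y)"

definition mixed_partial ::
    "nat \<Rightarrow> nat \<Rightarrow> (real \<Rightarrow> real \<Rightarrow> complex) \<Rightarrow> real \<Rightarrow> real \<Rightarrow> complex" where
  "mixed_partial k l u = (partial_x ^^ k) ((partial_y ^^ l) u)"

text \<open>A function is a solution on the open quadrant if every derivative occurring in the equation
  exists there and the equation holds. Existence is required explicitly because
  \<^const>\<open>vector_derivative\<close> is total: first the pure \<open>y\<close>-derivatives up to order \<open>M\<close>, then the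
  \<open>x\<close>-derivatives up to order \<open>N\<close> of each of these. The quadrant is open, so values of \<open>u\<close>
  outside of it play no role.\<close>

definition solves_pde :: "nat \<Rightarrow> (nat \<Rightarrow> complex) \<Rightarrow> nat \<Rightarrow> (nat \<Rightarrow> complex) \<Rightarrow>
    (real \<Rightarrow> real \<Rightarrow> complex) \<Rightarrow> (real \<Rightarrow> real \<Rightarrow> complex) \<Rightarrow> bool" where
  "solves_pde N a M b G u \<longleftrightarrow>
     (\<forall>x>0. \<forall>y>0.
        (\<forall>l<M. (\<lambda>t. mixed_partial 0 l u x t) differentiable (at y)) \<and>
        (\<forall>k<N. \<forall>l\<le>M. (\<lambda>t. mixed_partial k l u t y) differentiable (at x)) \<and>
        (\<Sum>k\<le>N. \<Sum>l\<le>M. a k * b l * mixed_partial k l u x y) = G x y)"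

end

theory Submission
  imports Defs
begin

text \<open>Expanding the geometric series \<open>1 / (exp t - 1) = (\<Sum>j\<ge>1. exp (- j t))\<close> turns the Lambert
  series of \<open>c\<close> into the exponential series \<open>\<Sum>n,m\<ge>1. A n m * exp (- n x - m y)\<close>, where \<open>A n m\<close> sums
  \<open>c\<close> over the divisors of \<open>n\<close> and \<open>m\<close>. On \<open>exp (- n x - m y)\<close> the differential operator acts as
  multiplication by \<open>P\<^sub>x(-n) P\<^sub>y(-m)\<close>, so the equation is solved by the exponential series with
  coefficients \<open>B n m = A n m / (P\<^sub>x(-n) P\<^sub>y(-m))\<close>, which by Moebius inversion is the Lambert series
  of \<open>S\<close>. For convergence and termwise differentiation, a Lambert series converges on the whole
  quadrant iff its coefficients grow subexponentially. This property passes from \<open>c\<close> to \<open>A\<close>, \<open>B\<close>,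
  \<open>S\<close> and to the coefficients of the derivatives, because \<open>P\<^sub>x\<close> and \<open>P\<^sub>y\<close> are bounded away
  from \<open>0\<close> on the negative integers.\<close>

section \<open>Moebius function and Moebius inversion over divisors\<close>

lemma moebius_mu_1 [simp]: "moebius_mu (Suc 0) = 1"
  by (simp add: moebius_mu_def)

text \<open>A new prime preserves squarefreeness and adds one prime factor, so only the sign
  changes. The case \<open>d = 0\<close> is excluded because \<open>p dvd 0\<close>.\<close>

lemma moebius_mu_prime_mult:
  assumes "prime p" "\<not> p dvd d"
  shows "moebius_mu (p * d) = - moebius_mu d"
proof -
  have d: "d > 0" using assms by (intro Nat.gr0I) auto
  have cop: "coprime p d" using assms prime_imp_coprime by blast
  have "squarefree (p * d) \<longleftrightarrow> squarefree d"
    using cop assms(1) squarefree_mult_coprime squarefree_multD(2) squarefree_prime by blast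
  moreover have "prime_factors (p * d) = insert p (prime_factors d)"
    using assms d by (simp add: prime_factors_product prime_prime_factors prime_gt_0_nat)
  moreover have "p \<notin> prime_factors d" using assms(2) by auto
  ultimately show ?thesis by (simp add: moebius_mu_def)
qed

lemma norm_moebius_mu_le_1: "norm (of_int (moebius_mu n) :: complex) \<le> 1"
  by (simp add: moebius_mu_def norm_power)

text \<open>For a prime \<open>p\<close> dividing \<open>n\<close>, the squarefree divisors of \<open>n\<close> cancel in pairs \<open>d\<close>, \<open>p * d\<close>
  with \<open>p\<close> not dividing \<open>d\<close>.\<close>

lemma sum_moebius_mu_divisors:
  assumes "n > 0"
  shows "(\<Sum>d | d dvd n. moebius_mu d) = (if n = 1 then 1 else 0)"
proof (cases "n = 1")
  case False
  then obtain p where p: "prime p" "p dvd n"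
    using prime_factor_nat by blast
  define A where "A = {d. d dvd n \<and> squarefree d}"
  define A0 where "A0 = {d \<in> A. \<not> p dvd d}"
  define A1 where "A1 = {d \<in> A. p dvd d}"
  have fin: "finite A" using assms by (simp add: A_def)
  have "(\<Sum>d | d dvd n. moebius_mu d) = sum moebius_mu A"
    by (rule sum.mono_neutral_right) (use assms in \<open>auto simp: A_def moebius_mu_def\<close>)
  also have "A = A0 \<union> A1" by (auto simp: A0_def A1_def)
  also have "sum moebius_mu (A0 \<union> A1) = sum moebius_mu A0 + sum moebius_mu A1"
    by (rule sum.union_disjoint) (use fin in \<open>auto simp: A0_def A1_def\<close>)
  also have "sum moebius_mu A1 = (\<Sum>d\<in>A0. - moebius_mu d)"
  proof (rule sum.reindex_bij_witness[of _ "\<lambda>d. p * d" "\<lambda>d. d div p"])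
    fix d assume d: "d \<in> A1"
    then obtain e where e: "d = p * e" by (auto simp: A1_def)
    have "\<not> p dvd e"
    proof
      assume "p dvd e"
      then have "p ^ 2 dvd d" by (auto simp: e power2_eq_square)
      with d p show False by (auto simp: A1_def A_def squarefree_def)
    qed
    moreover have "p > 0" using p by (simp add: prime_gt_0_nat)
    moreover have "e dvd n" "squarefree e"
      using d squarefree_multD(2) by (auto simp: e A1_def A_def dest: dvd_mult_right)
    ultimately show "p * (d div p) = d" "d div p \<in> A0" "- moebius_mu (d div p) = moebius_mu d"
      using p by (auto simp: e A0_def A_def moebius_mu_prime_mult)
  next
    fix d assume d: "d \<in> A0"
    then have "coprime p d" using p prime_imp_coprime by (auto simp: A0_def)
    then show "p * d div p = d" "p * d \<in> A1"
      using d p by (auto simp: A0_def A1_def A_def prime_gt_0_nat divides_mult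
        intro: squarefree_mult_coprime squarefree_prime)
  qed
  finally show ?thesis using False by (simp add: sum_negf)
qed simp

text \<open>After exchanging the sums, the divisors \<open>d\<close> of \<open>n\<close> that are
  multiples of \<open>e\<close> are \<open>e * j\<close> with \<open>j\<close> dividing
  \<open>n / e\<close>. The inner sum of Moebius values over \<open>j\<close> then vanishes unless
  \<open>e = n\<close>.\<close>

lemma moebius_inversion:
  fixes f :: "nat \<Rightarrow> complex"
  assumes "n > 0"
  shows "(\<Sum>d | d dvd n. \<Sum>e | e dvd d. f e * of_int (moebius_mu (d div e))) = f n"
proof -
  have fin: "finite {d. d dvd n}" using assms by simp
  \<comment> \<open>Writing the range of \<open>e\<close> as a restriction of the divisors of
    \<open>n\<close> gives both sums fixed finite index sets, the form in which
    \<open>sum.swap_restrict\<close> exchanges them.\<close>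
  have "(\<Sum>d | d dvd n. \<Sum>e | e dvd d. f e * of_int (moebius_mu (d div e)))
      = (\<Sum>d | d dvd n. \<Sum>e | e \<in> {e. e dvd n} \<and> e dvd d. f e * of_int (moebius_mu (d div e)))"
    by (intro sum.cong refl) (auto intro: dvd_trans)
  also have "\<dots> = (\<Sum>e | e dvd n. \<Sum>d | d \<in> {d. d dvd n} \<and> e dvd d. f e * of_int (moebius_mu (d div e)))"
    by (rule sum.swap_restrict[OF fin fin])
  also have "\<dots> = (\<Sum>e | e dvd n. if e = n then f e else 0)"
  proof (intro sum.cong refl)
    fix e assume "e \<in> {e. e dvd n}"
    then obtain q where q: "n = e * q" by auto
    with assms have pos: "e > 0" "q > 0" by auto
    have "(\<Sum>d | d \<in> {d. d dvd n} \<and> e dvd d. f e * of_int (moebius_mu (d div e)))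
        = (\<Sum>j | j dvd q. f e * of_int (moebius_mu j))"
    proof (rule sum.reindex_bij_witness[of _ "\<lambda>j. e * j" "\<lambda>d. d div e"])
      fix d assume "d \<in> {d. d \<in> {d. d dvd n} \<and> e dvd d}"
      then obtain j where "d = e * j" "j dvd q" using pos by (auto simp: q)
      then show "e * (d div e) = d" "d div e \<in> {j. j dvd q}"
          "f e * of_int (moebius_mu (d div e)) = f e * of_int (moebius_mu (d div e))"
        using pos by auto
    qed (use pos in \<open>auto simp: q\<close>)
    also have "\<dots> = f e * of_int (\<Sum>j | j dvd q. moebius_mu j)"
      by (simp add: sum_distrib_left)
    also have "\<dots> = (if e = n then f e else 0)"
      using pos by (simp add: sum_moebius_mu_divisors q)
    finally show "(\<Sum>d | d \<in> {d. d dvd n} \<and> e dvd d. f e * of_int (moebius_mu (d div e)))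
        = (if e = n then f e else 0)" .
  qed
  also have "\<dots> = f n" using fin by (simp add: sum.delta')
  finally show ?thesis .
qed

text \<open>The coefficient of \<open>exp (- n x - m y)\<close> after both geometric series are
  expanded; the same sum occurs inside \<open>coeff_B\<close>.\<close>

definition divisor_sum :: "(nat \<Rightarrow> nat \<Rightarrow> complex) \<Rightarrow> nat \<Rightarrow> nat \<Rightarrow> complex" where
  "divisor_sum c n m = (\<Sum>k | k dvd n. \<Sum>r | r dvd m. c k r)"

text \<open>The two variables separate: once the sums over \<open>r\<close> and \<open>d\<close> are
  exchanged, one-variable inversion removes the sums over \<open>r\<close> and \<delta> for fixed
  \<open>d\<close>, and a second inversion removes those over \<open>k\<close> and
  \<open>d\<close>.\<close>

lemma divisor_sum_coeff_S:
  assumes "n > 0" "m > 0"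
  shows "divisor_sum (coeff_S N a M b c) n m = coeff_B N a M b c n m"
proof -
  let ?B = "coeff_B N a M b c"
  have "divisor_sum (coeff_S N a M b c) n m =
      (\<Sum>k | k dvd n. \<Sum>d | d dvd k. \<Sum>r | r dvd m. \<Sum>\<delta> | \<delta> dvd r.
        ?B d \<delta> * of_int (moebius_mu (k div d)) * of_int (moebius_mu (r div \<delta>)))"
    unfolding divisor_sum_def coeff_S_def by (rule sum.cong[OF refl], rule sum.swap)
  also have "\<dots> = (\<Sum>k | k dvd n. \<Sum>d | d dvd k.
      (\<Sum>r | r dvd m. \<Sum>\<delta> | \<delta> dvd r. ?B d \<delta> * of_int (moebius_mu (r div \<delta>))) * of_int (moebius_mu (k div d)))"
    by (simp add: sum_distrib_right sum_distrib_left mult_ac)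
  also have "\<dots> = (\<Sum>k | k dvd n. \<Sum>d | d dvd k. ?B d m * of_int (moebius_mu (k div d)))"
    by (simp add: moebius_inversion assms)
  also have "\<dots> = ?B n m" by (rule moebius_inversion) fact
  finally show ?thesis .
qed

section \<open>Growth of the coefficients\<close>

text \<open>A nonconstant polynomial tends to infinity along the negative integers, and a constant
  one equals its nonzero value at -1. The finitely many remaining values are nonzero by
  hypothesis.\<close>

lemma symbol_poly_bounded_below:
  assumes "\<And>n::nat. n \<ge> 1 \<Longrightarrow> symbol_poly N a (- of_nat n) \<noteq> 0"
  shows "\<exists>\<delta>>0. \<forall>n\<ge>1. \<delta> \<le> norm (symbol_poly N a (- of_nat n))"
proof -
  have "\<exists>\<delta>>0. \<forall>\<^sub>F n in sequentially. \<delta> \<le> norm (symbol_poly N a (- of_nat n))"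
  proof (cases "\<exists>k. k \<noteq> 0 \<and> k \<le> N \<and> a k \<noteq> 0")
    case True
    have "filterlim (\<lambda>n. - of_nat n :: complex) at_infinity sequentially"
      by (intro filterlim_at_infinity_conv_norm_at_top[THEN iffD2])
        (simp add: filterlim_real_sequentially)
    from eventually_compose_filterlim[OF polyfun_extremal[OF True, of 1] this]
    show ?thesis by (intro exI[of _ 1]) (simp add: symbol_poly_def)
  next
    case False
    have "symbol_poly N a w = a 0" for w
    proof -
      have "symbol_poly N a w = (\<Sum>k\<in>{0}. a k * w ^ k)"
        unfolding symbol_poly_def by (rule sum.mono_neutral_right) (use False in auto)
      then show ?thesis by simp
    qed
    with assms[of 1] show ?thesis by (intro exI[of _ "norm (a 0)"]) auto
  qed
  then obtain \<delta> n0 where \<delta>: "\<delta> > 0"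
      "\<And>n. n \<ge> n0 \<Longrightarrow> \<delta> \<le> norm (symbol_poly N a (- of_nat n))"
    by (auto simp: eventually_sequentially)
  \<comment> \<open>The tail bound \<delta> is put beside the initial values, so one minimum is
    positive and bounds the symbol at every \<open>n >= 1\<close>.\<close>
  define F where "F = insert \<delta> ((\<lambda>n. norm (symbol_poly N a (- of_nat n))) ` {1..n0})"
  have "Min F \<in> F" by (rule Min_in) (auto simp: F_def)
  then have "Min F > 0" using \<delta>(1) assms by (auto simp: F_def)
  moreover have "Min F \<le> norm (symbol_poly N a (- of_nat n))" if "n \<ge> 1" for n
  proof (cases "n \<ge> n0")
    case True
    have "Min F \<le> \<delta>" by (rule Min_le) (auto simp: F_def)
    with \<delta>(2)[OF True] show ?thesis by linarith
  next
    case False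
    show ?thesis by (rule Min_le) (use False that in \<open>auto simp: F_def\<close>)
  qed
  ultimately show ?thesis by blast
qed

text \<open>The constant may depend on \<epsilon> but not on the indices. Index 0 is unconstrained
  because the series start at 1.\<close>

definition subexponential :: "(nat \<Rightarrow> nat \<Rightarrow> complex) \<Rightarrow> bool" where
  "subexponential f \<longleftrightarrow>
     (\<forall>\<epsilon>>0. \<exists>C\<ge>0. \<forall>n\<ge>1. \<forall>m\<ge>1. norm (f n m) \<le> C * exp (\<epsilon> * (real n + real m)))"

lemma subexponentialE:
  assumes "subexponential f" "\<epsilon> > 0"
  obtains C where "C \<ge> 0"
    "\<And>n m. n \<ge> 1 \<Longrightarrow> m \<ge> 1 \<Longrightarrow> norm (f n m) \<le> C * exp (\<epsilon> * (real n + real m))"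
proof -
  obtain C where "C \<ge> 0 \<and> (\<forall>n\<ge>1. \<forall>m\<ge>1. norm (f n m) \<le> C * exp (\<epsilon> * (real n + real m)))"
    using assms unfolding subexponential_def by presburger
  then show ?thesis by (intro that[of C]) simp_all
qed

text \<open>Half of the rate \<epsilon> is kept for the given bound. The other half absorbs the
  linear factors, since \<open>n <= exp (\<eta> n) / \<eta>\<close> with \<eta> equal to
  \<epsilon>/2.\<close>

lemma subexponentialI_linear_factors:
  assumes "\<And>\<epsilon>. \<epsilon> > 0 \<Longrightarrow> \<exists>C\<ge>0. \<forall>n\<ge>1. \<forall>m\<ge>1.
    norm (f n m) \<le> real n * real m * (C * exp (\<epsilon> * (real n + real m)))"
  shows "subexponential f"
  unfolding subexponential_def
proof (intro allI impI)
  fix \<epsilon> :: real assume \<epsilon>: "\<epsilon> > 0"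
  define \<eta> where "\<eta> = \<epsilon> / 2"
  have \<eta>: "\<eta> > 0" using \<epsilon> by (simp add: \<eta>_def)
  obtain C where C: "C \<ge> 0" "\<And>n m. n \<ge> 1 \<Longrightarrow> m \<ge> 1 \<Longrightarrow>
      norm (f n m) \<le> real n * real m * (C * exp (\<eta> * (real n + real m)))"
    using assms[OF \<eta>] by blast
  have lin: "real n \<le> exp (\<eta> * real n) / \<eta>" for n
  proof -
    have "\<eta> * real n \<le> exp (\<eta> * real n)" using exp_ge_add_one_self[of "\<eta> * real n"] by linarith
    then show ?thesis using \<eta> by (simp add: field_simps)
  qed
  have "norm (f n m) \<le> C / \<eta>\<^sup>2 * exp (\<epsilon> * (real n + real m))" if "n \<ge> 1" "m \<ge> 1" for n m
  proof -
    have "norm (f n m) \<le> real n * real m * (C * exp (\<eta> * (real n + real m)))"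
      by (rule C(2)[OF that])
    also have "\<dots> \<le> (exp (\<eta> * real n) / \<eta>) * (exp (\<eta> * real m) / \<eta>) * (C * exp (\<eta> * (real n + real m)))"
      using C(1) \<eta> by (intro mult_right_mono mult_mono lin) auto
    also have "\<dots> = C / \<eta>\<^sup>2 * (exp (\<eta> * real n) * exp (\<eta> * real m) * exp (\<eta> * (real n + real m)))"
      by (simp add: power2_eq_square)
    also have "exp (\<eta> * real n) * exp (\<eta> * real m) * exp (\<eta> * (real n + real m)) = exp (\<epsilon> * (real n + real m))"
      by (simp add: \<eta>_def exp_add[symmetric] field_simps)
    finally show ?thesis .
  qed
  moreover have "C / \<eta>\<^sup>2 \<ge> 0" using C(1) by simp
  ultimately show "\<exists>C\<ge>0. \<forall>n\<ge>1. \<forall>m\<ge>1. norm (f n m) \<le> C * exp (\<epsilon> * (real n + real m))"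
    by blast
qed

text \<open>The factor \<open>n * m\<close> is generous enough to cover both the division by the
  symbols and the factors \<open>-n\<close>, \<open>-m\<close> produced by differentiation.\<close>

lemma subexponential_mult:
  assumes "subexponential f" "K \<ge> 0"
    and "\<And>n m. n \<ge> 1 \<Longrightarrow> m \<ge> 1 \<Longrightarrow> norm (g n m) \<le> K * (real n * real m * norm (f n m))"
  shows "subexponential g"
proof (rule subexponentialI_linear_factors)
  fix \<epsilon> :: real assume "\<epsilon> > 0"
  then obtain C where C: "C \<ge> 0"
    "\<And>n m. n \<ge> 1 \<Longrightarrow> m \<ge> 1 \<Longrightarrow> norm (f n m) \<le> C * exp (\<epsilon> * (real n + real m))"
    using subexponentialE[OF assms(1)] by metis
  have "norm (g n m) \<le> real n * real m * (K * C * exp (\<epsilon> * (real n + real m)))"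
    if "n \<ge> 1" "m \<ge> 1" for n m
  proof -
    have "norm (g n m) \<le> K * (real n * real m * norm (f n m))" by (rule assms(3)[OF that])
    also have "\<dots> \<le> K * (real n * real m * (C * exp (\<epsilon> * (real n + real m))))"
      by (intro mult_left_mono C(2) that) (use assms(2) in auto)
    finally show ?thesis by (simp add: mult_ac)
  qed
  moreover have "K * C \<ge> 0" using C assms(2) by simp
  ultimately show "\<exists>C\<ge>0. \<forall>n\<ge>1. \<forall>m\<ge>1.
      norm (g n m) \<le> real n * real m * (C * exp (\<epsilon> * (real n + real m)))" by blast
qed

lemma card_divisors_le: "n \<ge> 1 \<Longrightarrow> card {d. d dvd n} \<le> (n::nat)"
proof -
  assume n: "n \<ge> 1"
  have "d \<in> {1..n}" if "d dvd n" for d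
    using that n by (cases d) (auto dest: dvd_imp_le)
  then have "card {d. d dvd n} \<le> card {1..n}" by (intro card_mono) auto
  then show ?thesis by simp
qed

text \<open>There are at most \<open>n * m\<close> pairs of divisors, and each pair is bounded by
  the exponential at \<open>(n, m)\<close> since divisors do not exceed the number. This serves
  \<open>divisor_sum\<close> and, as Moebius values have norm at most 1, also
  \<open>coeff_S\<close>.\<close>

lemma subexponential_divisors:
  assumes "subexponential f"
    and "\<And>n m. n \<ge> 1 \<Longrightarrow> m \<ge> 1 \<Longrightarrow> norm (g n m) \<le> (\<Sum>d | d dvd n. \<Sum>\<delta> | \<delta> dvd m. norm (f d \<delta>))"
  shows "subexponential g"
proof (rule subexponentialI_linear_factors)
  fix \<epsilon> :: real assume \<epsilon>: "\<epsilon> > 0"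
  then obtain C where C: "C \<ge> 0"
    "\<And>n m. n \<ge> 1 \<Longrightarrow> m \<ge> 1 \<Longrightarrow> norm (f n m) \<le> C * exp (\<epsilon> * (real n + real m))"
    using subexponentialE[OF assms(1)] by metis
  have "norm (g n m) \<le> real n * real m * (C * exp (\<epsilon> * (real n + real m)))"
    if nm: "n \<ge> 1" "m \<ge> 1" for n m
  proof -
    let ?K = "C * exp (\<epsilon> * (real n + real m))"
    have "norm (g n m) \<le> (\<Sum>d | d dvd n. \<Sum>\<delta> | \<delta> dvd m. norm (f d \<delta>))" by (rule assms(2)[OF nm])
    also have "\<dots> \<le> (\<Sum>d | d dvd n. \<Sum>\<delta> | \<delta> dvd m. ?K)"
    proof (intro sum_mono)
      fix d \<delta> assume "d \<in> {d. d dvd n}" "\<delta> \<in> {\<delta>. \<delta> dvd m}"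
      then have d: "1 \<le> d" "d \<le> n" "1 \<le> \<delta>" "\<delta> \<le> m"
        using nm by (auto simp: dvd_imp_le Suc_le_eq intro!: Nat.gr0I)
      have "norm (f d \<delta>) \<le> C * exp (\<epsilon> * (real d + real \<delta>))" by (rule C(2)) (use d in auto)
      also have "\<dots> \<le> ?K" using C(1) \<epsilon> d by (intro mult_left_mono) auto
      finally show "norm (f d \<delta>) \<le> ?K" .
    qed
    also have "\<dots> = real (card {d. d dvd n}) * real (card {\<delta>. \<delta> dvd m}) * ?K" by simp
    also have "\<dots> \<le> real n * real m * ?K"
      using C(1) nm by (intro mult_right_mono mult_mono) (auto simp: card_divisors_le)
    finally show ?thesis .
  qed
  with C(1) show "\<exists>C\<ge>0. \<forall>n\<ge>1. \<forall>m\<ge>1.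
      norm (g n m) \<le> real n * real m * (C * exp (\<epsilon> * (real n + real m)))" by blast
qed

lemma subexponential_coeff_B:
  assumes "\<And>n::nat. n \<ge> 1 \<Longrightarrow> symbol_poly N a (- of_nat n) \<noteq> 0"
    and "\<And>n::nat. n \<ge> 1 \<Longrightarrow> symbol_poly M b (- of_nat n) \<noteq> 0"
    and "subexponential c"
  shows "subexponential (coeff_B N a M b c)"
proof -
  obtain \<alpha> where \<alpha>: "\<alpha> > 0" "\<And>n. n \<ge> 1 \<Longrightarrow> \<alpha> \<le> norm (symbol_poly N a (- of_nat n))"
    using symbol_poly_bounded_below[of N a] assms(1) by blast
  obtain \<beta> where \<beta>: "\<beta> > 0" "\<And>n. n \<ge> 1 \<Longrightarrow> \<beta> \<le> norm (symbol_poly M b (- of_nat n))"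
    using symbol_poly_bounded_below[of M b] assms(2) by blast
  have A: "subexponential (divisor_sum c)"
    by (rule subexponential_divisors[OF assms(3)])
      (auto simp: divisor_sum_def intro!: sum_norm_le)
  show ?thesis
  proof (rule subexponential_mult[OF A, of "1 / (\<alpha> * \<beta>)"])
    fix n m :: nat assume nm: "n \<ge> 1" "m \<ge> 1"
    let ?P = "symbol_poly N a (- of_nat n)" and ?Q = "symbol_poly M b (- of_nat m)"
    have "norm (coeff_B N a M b c n m) = 1 / (norm ?P * norm ?Q) * norm (divisor_sum c n m)"
      by (simp add: coeff_B_def divisor_sum_def norm_mult norm_divide)
    also have "\<dots> \<le> 1 / (\<alpha> * \<beta>) * (real n * real m * norm (divisor_sum c n m))"
    proof (intro mult_mono)
      show "1 / (norm ?P * norm ?Q) \<le> 1 / (\<alpha> * \<beta>)"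
        using \<alpha>(1) \<beta>(1) by (intro divide_left_mono mult_mono \<alpha>(2) \<beta>(2) nm mult_pos_pos)
          (use assms nm in auto)
      \<comment> \<open>The harmless factor \<open>n * m >= 1\<close> only brings the bound into the
        shape of \<open>subexponential_mult\<close>.\<close>
      have "1 * 1 \<le> real n * real m" using nm by (intro mult_mono) auto
      then show "norm (divisor_sum c n m) \<le> real n * real m * norm (divisor_sum c n m)"
        using mult_right_mono[of 1 "real n * real m" "norm (divisor_sum c n m)"] by simp
    qed (use \<alpha>(1) \<beta>(1) in auto)
    finally show "norm (coeff_B N a M b c n m) \<le> 1 / (\<alpha> * \<beta>) * (real n * real m * norm (divisor_sum c n m))" .
  qed (use \<alpha>(1) \<beta>(1) in auto)
qed

lemma subexponential_coeff_S:
  assumes "subexponential (coeff_B N a M b c)"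
  shows "subexponential (coeff_S N a M b c)"
proof (rule subexponential_divisors[OF assms])
  fix n m :: nat
  let ?B = "coeff_B N a M b c"
  show "norm (coeff_S N a M b c n m) \<le> (\<Sum>d | d dvd n. \<Sum>\<delta> | \<delta> dvd m. norm (?B d \<delta>))"
    unfolding coeff_S_def
  proof (intro sum_norm_le)
    fix d \<delta>
    have "norm (?B d \<delta> * of_int (moebius_mu (n div d)) * of_int (moebius_mu (m div \<delta>)))
        \<le> norm (?B d \<delta>) * 1 * 1"
      unfolding norm_mult by (intro mult_mono norm_moebius_mu_le_1) auto
    then show "norm (?B d \<delta> * of_int (moebius_mu (n div d)) * of_int (moebius_mu (m div \<delta>)))
        \<le> norm (?B d \<delta>)" by simp
  qed
qed

section \<open>Unordered sums and exponential series\<close>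

text \<open>Tonelli's argument: nonnegativity turns convergence of the iterated sums into
  summability on the product.\<close>

lemma has_sum_prod_nonneg:
  fixes f :: "'a \<Rightarrow> real" and g :: "'b \<Rightarrow> real"
  assumes "(f has_sum s) A" "(g has_sum t) B"
    and "\<And>x. x \<in> A \<Longrightarrow> f x \<ge> 0" "\<And>y. y \<in> B \<Longrightarrow> g y \<ge> 0"
  shows "((\<lambda>(x, y). f x * g y) has_sum s * t) (A \<times> B)"
proof (rule has_sum_SigmaI)
  show in1: "((\<lambda>y. case (x, y) of (x, y) \<Rightarrow> f x * g y) has_sum f x * t) B" for x
    using has_sum_cmult_right[OF assms(2)] by simp
  show out: "((\<lambda>x. f x * t) has_sum s * t) A"
    using has_sum_cmult_left[OF assms(1)] by simp
  show "(\<lambda>(x, y). f x * g y) summable_on A \<times> B"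
  proof (rule summable_on_SigmaI[OF in1])
    show "(\<lambda>x. f x * t) summable_on A" using out by (rule has_sum_imp_summable)
  qed (use assms(3,4) in simp)
qed

lemma has_sum_sum:
  fixes f :: "'a \<Rightarrow> 'b \<Rightarrow> 'c :: topological_comm_monoid_add"
  assumes "\<And>i. i \<in> I \<Longrightarrow> (f i has_sum s i) A"
  shows "((\<lambda>x. \<Sum>i\<in>I. f i x) has_sum (\<Sum>i\<in>I. s i)) A"
  using assms
proof (induction I rule: infinite_finite_induct)
  case (insert i I)
  then have "((\<lambda>x. f i x + (\<Sum>i\<in>I. f i x)) has_sum s i + (\<Sum>i\<in>I. s i)) A"
    by (intro has_sum_add) simp_all
  with insert.hyps show ?case by simp
qed simp_all

lemma has_sum_exp_from_1:
  fixes t :: real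
  assumes "t > 0"
  shows "((\<lambda>n. exp (- (real n * t))) has_sum 1 / (exp t - 1)) {1..}"
proof -
  have "((\<lambda>n. exp (- t) ^ n) has_sum exp (- t) / (1 - exp (- t))) {1..}"
    by (rule has_sum_geometric_from_1) (use assms in auto)
  moreover have "exp (- t) / (1 - exp (- t)) = 1 / (exp t - 1)"
    using assms by (simp add: field_simps exp_minus)
  moreover have "exp (- t) ^ n = exp (- (real n * t))" for n
    by (simp add: exp_of_nat_mult[symmetric])
  ultimately show ?thesis by simp
qed

definition exp_term :: "(nat \<Rightarrow> nat \<Rightarrow> complex) \<Rightarrow> real \<Rightarrow> real \<Rightarrow> nat \<times> nat \<Rightarrow> complex" where
  "exp_term f x y = (\<lambda>(n, m). f n m * (of_real (exp (- (real n * x))) * of_real (exp (- (real m * y)))))"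

definition exp_series :: "(nat \<Rightarrow> nat \<Rightarrow> complex) \<Rightarrow> real \<Rightarrow> real \<Rightarrow> complex" where
  "exp_series f x y = (\<Sum>\<^sub>\<infinity>p\<in>{1..} \<times> {1..}. exp_term f x y p)"

lemma norm_exp_term:
  "norm (exp_term f x y (n, m)) = norm (f n m) * (exp (- (real n * x)) * exp (- (real m * y)))"
  by (simp add: exp_term_def norm_mult del: of_real_exp)

lemma exp_term_summable:
  assumes "subexponential f" "x > 0" "y > 0"
  shows "exp_term f x y summable_on ({1..} \<times> {1..})"
proof -
  \<comment> \<open>Both \<open>x\<close> and \<open>y\<close> are at least 2\<epsilon>: one
    \<epsilon> compensates the growth of \<open>f\<close>, the other leaves a convergent product of
    geometric series.\<close>
  define \<epsilon> where "\<epsilon> = min x y / 2"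
  have \<epsilon>: "\<epsilon> > 0" "2 * \<epsilon> \<le> x" "2 * \<epsilon> \<le> y" using assms by (auto simp: \<epsilon>_def)
  obtain C where C: "C \<ge> 0"
    "\<And>n m. n \<ge> 1 \<Longrightarrow> m \<ge> 1 \<Longrightarrow> norm (f n m) \<le> C * exp (\<epsilon> * (real n + real m))"
    using subexponentialE[OF assms(1) \<epsilon>(1)] by metis
  have E: "((\<lambda>n. exp (- (real n * \<epsilon>))) has_sum 1 / (exp \<epsilon> - 1)) {1..}"
    by (rule has_sum_exp_from_1) (rule \<epsilon>)
  have "(\<lambda>p. case p of (n, m) \<Rightarrow> exp (- (real n * \<epsilon>)) * exp (- (real m * \<epsilon>))) summable_on ({1..} \<times> {1..})"
    using has_sum_prod_nonneg[OF E E] by (auto simp: summable_on_def)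
  then have "(\<lambda>p. C * (case p of (n, m) \<Rightarrow> exp (- (real n * \<epsilon>)) * exp (- (real m * \<epsilon>)))) summable_on ({1..} \<times> {1..})"
    by (rule summable_on_cmult_right)
  then have "(\<lambda>p. norm (exp_term f x y p)) summable_on ({1..} \<times> {1..})"
  proof (rule summable_on_comparison_test)
    fix p :: "nat \<times> nat" assume "p \<in> {1..} \<times> {1..}"
    then obtain n m where p: "p = (n, m)" "n \<ge> 1" "m \<ge> 1" by auto
    have "norm (exp_term f x y p) = norm (f n m) * exp (- (real n * x) - real m * y)"
      by (simp add: norm_exp_term p exp_diff exp_minus field_simps)
    also have "\<dots> \<le> C * exp (\<epsilon> * (real n + real m)) * exp (- (real n * (2 * \<epsilon>)) - real m * (2 * \<epsilon>))"
      using \<epsilon> C by (intro mult_mono C p) (auto intro!: diff_mono mult_left_mono)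
    also have "\<dots> = C * (exp (- (real n * \<epsilon>)) * exp (- (real m * \<epsilon>)))"
      by (simp add: exp_add[symmetric] algebra_simps)
    finally show "norm (exp_term f x y p) \<le> C * (case p of (n, m) \<Rightarrow> exp (- (real n * \<epsilon>)) * exp (- (real m * \<epsilon>)))"
      by (simp add: p)
  qed auto
  then show ?thesis by (rule abs_summable_summable)
qed

section \<open>Lambert series: convergence and expansion\<close>

text \<open>The factor \<open>1 - exp (- x)\<close> does not depend on \<open>n\<close>, so Lambert
  terms are dominated by exponential terms up to a constant depending on \<open>x\<close> and
  \<open>y\<close> alone.\<close>

lemma exp_ge_mult_exp_minus_1:
  fixes x :: real
  assumes "n \<ge> 1" "x > 0"
  shows "exp (real n * x) * (1 - exp (- x)) \<le> exp (real n * x) - 1"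
proof -
  have "1 \<le> exp (real n * x - x)" using assms by (simp add: algebra_simps)
  then show ?thesis by (simp add: algebra_simps exp_diff exp_minus field_simps)
qed

lemma lambert_term_norm:
  assumes "x > 0" "y > 0"
  shows "norm (lambert_term f x y (n, m)) =
    norm (f n m) / ((exp (real n * x) - 1) * (exp (real m * y) - 1))"
proof -
  have "(exp (real n * x) - 1) * (exp (real m * y) - 1) \<ge> 0" using assms by simp
  then show ?thesis
    unfolding lambert_term_def by (simp add: norm_divide del: of_real_mult of_real_diff of_real_exp)
qed

lemma subexponential_imp_lambert_convergent:
  assumes "subexponential f"
  shows "lambert_convergent f"
  unfolding lambert_convergent_def
proof (intro allI impI)
  fix x y :: real assume xy: "x > 0" "y > 0"
  define K where "K = inverse ((1 - exp (- x)) * (1 - exp (- y)))"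
  have "(\<lambda>p. norm (exp_term f x y p)) summable_on ({1..} \<times> {1..})"
    using exp_term_summable[OF assms xy] by (simp add: summable_on_iff_abs_summable_on_complex)
  then have "(\<lambda>p. K * norm (exp_term f x y p)) summable_on ({1..} \<times> {1..})"
    by (rule summable_on_cmult_right)
  then have "(\<lambda>p. norm (lambert_term f x y p)) summable_on ({1..} \<times> {1..})"
  proof (rule summable_on_comparison_test)
    fix p :: "nat \<times> nat" assume "p \<in> {1..} \<times> {1..}"
    then obtain n m where p: "p = (n, m)" "n \<ge> 1" "m \<ge> 1" by auto
    have "norm (lambert_term f x y p) = norm (f n m) / ((exp (real n * x) - 1) * (exp (real m * y) - 1))"
      using xy by (simp add: p lambert_term_norm)
    also have "\<dots> \<le> norm (f n m) / ((exp (real n * x) * (1 - exp (- x))) * (exp (real m * y) * (1 - exp (- y))))"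
      using xy p by (intro divide_left_mono mult_mono mult_pos_pos exp_ge_mult_exp_minus_1) auto
    also have "\<dots> = K * norm (exp_term f x y p)"
      by (simp add: K_def p norm_exp_term exp_minus divide_simps)
    finally show "norm (lambert_term f x y p) \<le> K * norm (exp_term f x y p)" .
  qed auto
  then show "lambert_term f x y summable_on ({1..} \<times> {1..})" by (rule abs_summable_summable)
qed

text \<open>Convergence at the single point \<open>(\<epsilon>, \<epsilon>)\<close> yields the bound
  for the rate \<epsilon>: each term is at most the total sum of norms, which serves as the
  constant.\<close>

lemma lambert_convergent_imp_subexponential:
  assumes "lambert_convergent f"
  shows "subexponential f"
  unfolding subexponential_def
proof (intro allI impI)
  fix \<epsilon> :: real assume \<epsilon>: "\<epsilon> > 0"
  let ?t = "lambert_term f \<epsilon> \<epsilon>"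
  have s: "(\<lambda>p. norm (?t p)) summable_on ({1..} \<times> {1..})"
    using assms \<epsilon> by (simp add: lambert_convergent_def summable_on_iff_abs_summable_on_complex[symmetric])
  define C where "C = (\<Sum>\<^sub>\<infinity>p\<in>{1..} \<times> {1..}. norm (?t p))"
  have "norm (f n m) \<le> C * exp (\<epsilon> * (real n + real m))" if nm: "n \<ge> 1" "m \<ge> 1" for n m
  proof -
    have "(\<Sum>p\<in>{(n, m)}. norm (?t p)) \<le> C"
      unfolding C_def by (rule finite_sum_le_infsum[OF s]) (use nm in auto)
    then have "norm (f n m) / ((exp (real n * \<epsilon>) - 1) * (exp (real m * \<epsilon>) - 1)) \<le> C"
      using \<epsilon> by (simp add: lambert_term_norm)
    moreover have pos: "exp (real n * \<epsilon>) - 1 > 0" "exp (real m * \<epsilon>) - 1 > 0" using nm \<epsilon> by auto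
    then have "(exp (real n * \<epsilon>) - 1) * (exp (real m * \<epsilon>) - 1) > 0" by (rule mult_pos_pos)
    ultimately have "norm (f n m) \<le> C * ((exp (real n * \<epsilon>) - 1) * (exp (real m * \<epsilon>) - 1))"
      by (subst (asm) pos_divide_le_eq) auto
    also have "\<dots> \<le> C * (exp (real n * \<epsilon>) * exp (real m * \<epsilon>))"
      using pos by (intro mult_left_mono mult_mono) (auto simp: C_def infsum_nonneg)
    finally show ?thesis by (simp add: exp_add[symmetric] algebra_simps)
  qed
  moreover have "C \<ge> 0" by (simp add: C_def infsum_nonneg)
  ultimately show "\<exists>C\<ge>0. \<forall>n\<ge>1. \<forall>m\<ge>1. norm (f n m) \<le> C * exp (\<epsilon> * (real n + real m))"
    by blast
qed

text \<open>One fourfold family \<open>h\<close> is summed in two ways. Summing over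
  \<open>(i, j)\<close> first gives the Lambert terms; grouping by \<open>n = i * k\<close>,
  \<open>m = j * r\<close> gives the exponential terms.\<close>

lemma lambert_series_eq_exp_series:
  assumes "lambert_convergent c" "x > 0" "y > 0"
  shows "lambert_series c x y = exp_series (divisor_sum c) x y"
proof -
  let ?P = "{1..} \<times> {1..} :: (nat \<times> nat) set"
  let ?e = "\<lambda>i t. exp (- (real i * t))"
  define h :: "(nat \<times> nat) \<times> (nat \<times> nat) \<Rightarrow> complex" where
    "h = (\<lambda>((k, r), (i, j)). c k r * of_real (?e (i * k) x * ?e (j * r) y))"
  define D where "D = (\<lambda>(n, m). {k. k dvd n} \<times> {r. r dvd m} :: (nat \<times> nat) set)"
  define \<phi> :: "(nat \<times> nat) \<times> (nat \<times> nat) \<Rightarrow> (nat \<times> nat) \<times> (nat \<times> nat)" where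
    "\<phi> = (\<lambda>((n, m), (k, r)). ((k, r), (n div k, m div r)))"
  have geo: "((\<lambda>(i, j). ?e (i * k) x * ?e (j * r) y) has_sum
      1 / ((exp (real k * x) - 1) * (exp (real r * y) - 1))) ?P" if "k \<ge> 1" "r \<ge> 1" for k r
    using has_sum_prod_nonneg[OF has_sum_exp_from_1[of "real k * x"] has_sum_exp_from_1[of "real r * y"]]
      assms that by (simp add: mult.assoc)
  \<comment> \<open>Absolute summability justifies both groupings: for fixed \<open>(k, r)\<close>
    the norms of \<open>h\<close> sum to the norm of the Lambert term.\<close>
  have sum_h: "h summable_on (?P \<times> ?P)"
  proof (rule abs_summable_summable, rule summable_on_SigmaI)
    show "(\<lambda>p. norm (lambert_term c x y p)) summable_on ?P"
      using assms by (simp add: lambert_convergent_def summable_on_iff_abs_summable_on_complex[symmetric])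
  next
    fix p assume "p \<in> ?P"
    then obtain k r where p: "p = (k, r)" "k \<ge> 1" "r \<ge> 1" by auto
    have "(\<lambda>q. norm (h (p, q))) = (\<lambda>q. norm (c k r) * (case q of (i, j) \<Rightarrow> ?e (i * k) x * ?e (j * r) y))"
      by (auto simp: h_def p norm_mult fun_eq_iff)
    then show "((\<lambda>q. norm (h (p, q))) has_sum norm (lambert_term c x y p)) ?P"
      using has_sum_cmult_right[OF geo[OF p(2,3)], of "norm (c k r)"] assms
      by (simp add: p lambert_term_norm)
  qed auto
  have h: "(h has_sum lambert_series c x y) (?P \<times> ?P)"
  proof (rule has_sum_SigmaI[OF _ _ sum_h])
    show "(lambert_term c x y has_sum lambert_series c x y) ?P"
      using assms by (auto simp: lambert_series_def lambert_convergent_def)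
  next
    fix p assume "p \<in> ?P"
    then obtain k r where p: "p = (k, r)" "k \<ge> 1" "r \<ge> 1" by auto
    have "(\<lambda>q. h (p, q)) = (\<lambda>q. c k r * of_real (case q of (i, j) \<Rightarrow> ?e (i * k) x * ?e (j * r) y))"
      by (auto simp: h_def p fun_eq_iff)
    then show "((\<lambda>q. h (p, q)) has_sum lambert_term c x y p) ?P"
      using has_sum_cmult_right[OF has_sum_of_real[OF geo[OF p(2,3)]], of "c k r"]
      by (simp add: p lambert_term_def)
  qed
  \<comment> \<open>A pair \<open>(n, m)\<close> with chosen divisors \<open>(k, r)\<close>
    corresponds to \<open>(k, r)\<close> with the cofactors
    \<open>(n div k, m div r)\<close>.\<close>
  have "bij_betw \<phi> (Sigma ?P D) (?P \<times> ?P)"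
  proof (rule bij_betwI[of _ _ _ "\<lambda>((k, r), (i, j)). ((i * k, j * r), (k, r))"])
    show "\<phi> \<in> Sigma ?P D \<rightarrow> ?P \<times> ?P"
      by (auto simp: \<phi>_def D_def Suc_le_eq intro!: Nat.gr0I)
  qed (auto simp: \<phi>_def D_def Suc_le_eq)
  from has_sum_reindex_bij_betw[OF this, of h] h
  have "((\<lambda>q. h (\<phi> q)) has_sum lambert_series c x y) (Sigma ?P D)" by simp
  then have "(exp_term (divisor_sum c) x y has_sum lambert_series c x y) ?P"
  proof (rule has_sum_SigmaD)
    fix p assume "p \<in> ?P"
    then obtain n m where p: "p = (n, m)" "n \<ge> 1" "m \<ge> 1" by auto
    have fin: "finite (D p)" using p by (simp add: D_def)
    have "(\<Sum>q\<in>D p. h (\<phi> (p, q))) = (\<Sum>(k, r)\<in>D p. c k r * (of_real (?e n x) * of_real (?e m y)))"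
    proof (rule sum.cong[OF refl])
      fix q assume "q \<in> D p"
      then obtain k r where "q = (k, r)" "k dvd n" "r dvd m" by (auto simp: D_def p)
      moreover from this have "real (n div k) * real k = real n" "real (m div r) * real r = real m"
        by (simp_all flip: of_nat_mult)
      ultimately show "h (\<phi> (p, q)) = (case q of (k, r) \<Rightarrow> c k r * (of_real (?e n x) * of_real (?e m y)))"
        by (simp add: h_def \<phi>_def p)
    qed
    also have "\<dots> = exp_term (divisor_sum c) x y p"
      by (simp add: exp_term_def divisor_sum_def p D_def sum_distrib_right sum.cartesian_product case_prod_unfold)
    finally show "((\<lambda>q. h (\<phi> (p, q))) has_sum exp_term (divisor_sum c) x y p) (D p)"
      using fin by (intro has_sum_finiteI) auto
  qed
  then show ?thesis by (simp add: exp_series_def infsumI)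
qed

section \<open>Termwise differentiation\<close>

text \<open>Setting the coefficient at index 0 to zero turns the sum from 1 into a full power series
  in \<open>exp (- t)\<close>, ready for the theorems on differentiating power series.\<close>

lemma exp_sum_sums:
  fixes h :: "nat \<Rightarrow> complex"
  assumes "(\<lambda>n. h n * of_real (exp (- (real n * t)))) summable_on {1..}"
  shows "(\<lambda>n. (if n = 0 then 0 else h n) * of_real (exp (- t)) ^ n) sums
    (\<Sum>\<^sub>\<infinity>n\<in>{1..}. h n * of_real (exp (- (real n * t))))"
proof (rule has_sum_imp_sums)
  let ?S = "\<Sum>\<^sub>\<infinity>n\<in>{1..}. h n * of_real (exp (- (real n * t)))"
  have "((\<lambda>n. h n * of_real (exp (- (real n * t)))) has_sum ?S) {1..}"
    using assms by simp
  also have "?this \<longleftrightarrow> ((\<lambda>n. (if n = 0 then 0 else h n) * of_real (exp (- t)) ^ n) has_sum ?S) UNIV"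
    by (rule has_sum_cong_neutral)
      (auto simp: of_real_power[symmetric] exp_of_nat_mult[symmetric] simp del: of_real_power of_real_exp)
  finally show "((\<lambda>n. (if n = 0 then 0 else h n) * of_real (exp (- t)) ^ n) has_sum ?S) UNIV" .
qed

text \<open>An exponential sum is a power series in \<open>z = exp (- t)\<close>, and \<open>d/dt\<close> acts as \<open>- z d/dz\<close>.\<close>

lemma exp_sum_has_vector_derivative:
  fixes g :: "nat \<Rightarrow> complex"
  assumes s: "\<And>t. t > 0 \<Longrightarrow> (\<lambda>n. g n * of_real (exp (- (real n * t)))) summable_on {1..}"
    and d: "(\<lambda>n. - of_nat n * g n * of_real (exp (- (real n * x)))) summable_on {1..}"
    and x: "x > 0"
  shows "((\<lambda>t. \<Sum>\<^sub>\<infinity>n\<in>{1..}. g n * of_real (exp (- (real n * t)))) has_vector_derivative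
    (\<Sum>\<^sub>\<infinity>n\<in>{1..}. - of_nat n * g n * of_real (exp (- (real n * x))))) (at x)"
proof -
  define a where "a n = (if n = 0 then 0 else g n)" for n
  define F where "F w = (\<Sum>n. a n * w ^ n)" for w :: complex
  define z :: complex where "z = of_real (exp (- x))"
  \<comment> \<open>The series converges at \<open>K\<close>, the value of \<open>exp (- t)\<close>
    at \<open>t = x / 2\<close>; as \<open>K\<close> has larger norm than \<open>z\<close>, the
    point \<open>z\<close> lies strictly inside the disc of convergence.\<close>
  define K :: complex where "K = of_real (exp (- (x / 2)))"
  let ?S = "\<Sum>\<^sub>\<infinity>n\<in>{1..}. - of_nat n * g n * of_real (exp (- (real n * x)))"
  let ?D = "\<Sum>n. diffs a n * z ^ n"
  have K: "summable (\<lambda>n. a n * K ^ n)"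
    using exp_sum_sums[OF s[of "x / 2"]] x by (simp add: a_def K_def sums_iff)
  have zK: "norm z < norm K" using x by (simp add: z_def K_def)
  have F': "(F has_field_derivative ?D) (at z)"
    unfolding F_def by (rule termdiffs_strong[OF K zK])
  have "summable (\<lambda>n. diffs a n * z ^ n)"
    by (rule termdiff_converges[OF zK]) (rule powser_inside[OF K])
  \<comment> \<open>The factor \<open>- z\<close> is the derivative of \<open>exp (- t)\<close> from
    the chain rule. It restores the power lost by differentiation.\<close>
  from sums_mult2[OF diffs_equiv[OF this], of "- z"]
  have "(\<lambda>n. (of_nat n * a n * z ^ (n - Suc 0)) * (- z)) sums (?D * (- z))" .
  moreover have "(of_nat n * a n * z ^ (n - Suc 0)) * (- z) = (if n = 0 then 0 else - of_nat n * g n) * z ^ n" for n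
    by (cases n) (auto simp: a_def algebra_simps)
  ultimately have S: "?D * (- z) = ?S"
    using exp_sum_sums[OF d] by (simp add: z_def sums_unique2)
  have "((\<lambda>t. of_real (exp (- t)) :: complex) has_vector_derivative - z) (at x)"
    unfolding z_def of_real_minus[symmetric]
    by (intro has_vector_derivative_of_real) (auto intro!: derivative_eq_intros)
  from field_vector_diff_chain_at[OF this] F'
  have "(F \<circ> (\<lambda>t. of_real (exp (- t))) has_vector_derivative - z * ?D) (at x)"
    by (simp add: z_def)
  then have "((\<lambda>t. F (of_real (exp (- t)))) has_vector_derivative ?S) (at x)"
    using S by (simp add: o_def mult.commute)
  \<comment> \<open>The power series is known to agree with the exponential sum only for
    \<open>t > 0\<close>, so the derivative is transferred on that open set.\<close>
  then show ?thesis
  proof (rule has_vector_derivative_transform_within_open[of _ _ _ "{0<..}"])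
    fix t :: real assume "t \<in> {0<..}"
    then show "F (of_real (exp (- t))) = (\<Sum>\<^sub>\<infinity>n\<in>{1..}. g n * of_real (exp (- (real n * t))))"
      using exp_sum_sums[OF s[of t]] by (simp add: F_def a_def sums_iff)
  qed (use x in auto)
qed

lemma subexponential_mult_n:
  assumes "subexponential f"
  shows "subexponential (\<lambda>n m. - of_nat n * f n m)"
proof (rule subexponential_mult[OF assms, of 1])
  fix n m :: nat assume "m \<ge> 1"
  then have "1 * norm (f n m) \<le> real m * norm (f n m)" by (intro mult_right_mono) auto
  then have "real n * norm (f n m) \<le> real n * (real m * norm (f n m))"
    by (intro mult_left_mono) auto
  then show "norm (- of_nat n * f n m) \<le> 1 * (real n * real m * norm (f n m))"
    by (simp add: norm_mult mult.assoc)
qed auto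

lemma subexponential_swap: "subexponential f \<Longrightarrow> subexponential (\<lambda>n m. f m n)"
  unfolding subexponential_def by (subst add.commute) meson

lemma subexponential_mult_m:
  assumes "subexponential f"
  shows "subexponential (\<lambda>n m. - of_nat m * f n m)"
  using subexponential_swap[OF subexponential_mult_n[OF subexponential_swap[OF assms]]] .

text \<open>This symmetry reduces differentiation in \<open>y\<close> to differentiation in
  \<open>x\<close>.\<close>

lemma exp_series_swap: "exp_series f x y = exp_series (\<lambda>n m. f m n) y x"
proof -
  have "bij_betw prod.swap ({1..} \<times> {1..} :: (nat \<times> nat) set) ({1..} \<times> {1..})"
    by (rule bij_betwI[of _ _ _ prod.swap]) auto
  from infsum_reindex_bij_betw[OF this, of "exp_term f x y"] show ?thesis
    unfolding exp_series_def by (simp add: exp_term_def case_prod_unfold mult_ac)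
qed

text \<open>Fubini: carrying out the sum over \<open>m\<close> leaves a one-variable exponential sum
  in \<open>x\<close> whose coefficients depend on \<open>y\<close>.\<close>

lemma exp_series_iterated:
  assumes "subexponential f" "x > 0" "y > 0"
  defines "g \<equiv> \<lambda>n. \<Sum>\<^sub>\<infinity>m\<in>{1..}. f n m * of_real (exp (- (real m * y)))"
  shows "(\<lambda>n. g n * of_real (exp (- (real n * x)))) summable_on {1..}"
    and "exp_series f x y = (\<Sum>\<^sub>\<infinity>n\<in>{1..}. g n * of_real (exp (- (real n * x))))"
proof -
  have e: "(\<lambda>(n, m). exp_term f x y (n, m)) summable_on ({1..} \<times> {1..})"
    using exp_term_summable[OF assms(1-3)] by simp
  have g: "(\<Sum>\<^sub>\<infinity>m\<in>{1..}. exp_term f x y (n, m)) = g n * of_real (exp (- (real n * x)))" for n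
    unfolding g_def infsum_cmult_left'[symmetric] by (simp add: exp_term_def mult_ac)
  show "(\<lambda>n. g n * of_real (exp (- (real n * x)))) summable_on {1..}"
    using summable_on_Sigma_banach[OF e] by (simp only: g)
  show "exp_series f x y = (\<Sum>\<^sub>\<infinity>n\<in>{1..}. g n * of_real (exp (- (real n * x))))"
    using infsum_Sigma'_banach[OF e] unfolding g by (simp add: exp_series_def)
qed

lemma has_vector_derivative_cong_pos:
  fixes f g :: "real \<Rightarrow> complex"
  assumes "(g has_vector_derivative D) (at x)" "x > 0" "\<And>t. t > 0 \<Longrightarrow> f t = g t"
  shows "(f has_vector_derivative D) (at x)"
  by (rule has_vector_derivative_transform_within_open[OF assms(1), of "{0<..}"])
    (use assms(2,3) in auto)

text \<open>With \<open>y\<close> fixed, the one-variable result applies to the inner sums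
  \<open>g n\<close>. The factor \<open>-n\<close> passes through the sum over \<open>m\<close>, so
  the derivative is again a double exponential series.\<close>

lemma exp_series_has_vector_derivative_x:
  assumes "subexponential f" "x > 0" "y > 0"
  shows "((\<lambda>t. exp_series f t y) has_vector_derivative exp_series (\<lambda>n m. - of_nat n * f n m) x y) (at x)"
proof -
  define g where "g n = (\<Sum>\<^sub>\<infinity>m\<in>{1..}. f n m * of_real (exp (- (real m * y))))" for n
  have g': "(\<Sum>\<^sub>\<infinity>m\<in>{1..}. - of_nat n * f n m * of_real (exp (- (real m * y)))) = - of_nat n * g n" for n
    unfolding g_def infsum_cmult_right'[symmetric] by (simp add: mult_ac)
  note f' = subexponential_mult_n[OF assms(1)]
  have "((\<lambda>t. \<Sum>\<^sub>\<infinity>n\<in>{1..}. g n * of_real (exp (- (real n * t)))) has_vector_derivative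
      (\<Sum>\<^sub>\<infinity>n\<in>{1..}. - of_nat n * g n * of_real (exp (- (real n * x))))) (at x)"
  proof (rule exp_sum_has_vector_derivative)
    show "(\<lambda>n. g n * of_real (exp (- (real n * t)))) summable_on {1..}" if "t > 0" for t
      unfolding g_def by (rule exp_series_iterated(1)) fact+
    show "(\<lambda>n. - of_nat n * g n * of_real (exp (- (real n * x)))) summable_on {1..}"
      using exp_series_iterated(1)[OF f' assms(2,3)] by (simp only: g')
  qed fact
  also have "(\<Sum>\<^sub>\<infinity>n\<in>{1..}. - of_nat n * g n * of_real (exp (- (real n * x))))
      = exp_series (\<lambda>n m. - of_nat n * f n m) x y"
    using exp_series_iterated(2)[OF f' assms(2,3)] by (simp only: g')
  finally show ?thesis
  proof (rule has_vector_derivative_cong_pos)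
    show "exp_series f t y = (\<Sum>\<^sub>\<infinity>n\<in>{1..}. g n * of_real (exp (- (real n * t))))" if "t > 0" for t
      unfolding g_def by (rule exp_series_iterated(2)) fact+
  qed fact
qed

lemma exp_series_has_vector_derivative_y:
  assumes "subexponential f" "x > 0" "y > 0"
  shows "((\<lambda>t. exp_series f x t) has_vector_derivative exp_series (\<lambda>n m. - of_nat m * f n m) x y) (at y)"
  using exp_series_has_vector_derivative_x[OF subexponential_swap[OF assms(1)] assms(3,2)]
  unfolding exp_series_swap[of f x] exp_series_swap[of "\<lambda>n m. - of_nat m * f n m" x] .

section \<open>Higher partial derivatives and the differential equation\<close>

definition derivative_coeffs :: "nat \<Rightarrow> nat \<Rightarrow> (nat \<Rightarrow> nat \<Rightarrow> complex) \<Rightarrow> nat \<Rightarrow> nat \<Rightarrow> complex" where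
  "derivative_coeffs k l f n m = (- of_nat n) ^ k * (- of_nat m) ^ l * f n m"

lemma derivative_coeffs_0 [simp]: "derivative_coeffs 0 0 f = f"
  by (simp add: derivative_coeffs_def fun_eq_iff)

lemma derivative_coeffs_Suc:
  "derivative_coeffs (Suc k) l f = (\<lambda>n m. - of_nat n * derivative_coeffs k l f n m)"
  "derivative_coeffs k (Suc l) f = (\<lambda>n m. - of_nat m * derivative_coeffs k l f n m)"
  by (simp_all add: derivative_coeffs_def fun_eq_iff mult_ac)

lemma subexponential_derivative_coeffs:
  assumes "subexponential f"
  shows "subexponential (derivative_coeffs k l f)"
proof (induction k)
  case 0
  show ?case
  proof (induction l)
    case (Suc l)
    then show ?case unfolding derivative_coeffs_Suc(2) by (rule subexponential_mult_m)
  qed (simp add: assms)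
next
  case (Suc k)
  then show ?case unfolding derivative_coeffs_Suc(1) by (rule subexponential_mult_n)
qed

text \<open>The induction follows \<open>mixed_partial\<close>: first the
  \<open>y\<close>-derivatives, then the \<open>x\<close>-derivatives. Agreement of \<open>u\<close>
  with the series on the open quadrant suffices, since derivatives there are local.\<close>

lemma mixed_partial_exp_series:
  assumes "subexponential f" "\<And>x y. x > 0 \<Longrightarrow> y > 0 \<Longrightarrow> u x y = exp_series f x y"
    and "x > 0" "y > 0"
  shows "mixed_partial k l u x y = exp_series (derivative_coeffs k l f) x y"
  using assms(3,4)
proof (induction k arbitrary: x y)
  case 0
  then show ?case
  proof (induction l arbitrary: x y)
    case 0
    then show ?case by (simp add: mixed_partial_def assms(2))
  next
    case (Suc l)
    \<comment> \<open>The induction hypothesis holds at every point of the quadrant, hence along the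
      whole half-line \<open>t > 0\<close> on which the derivative is taken.\<close>
    have "((\<lambda>t. mixed_partial 0 l u x t) has_vector_derivative
        exp_series (derivative_coeffs 0 (Suc l) f) x y) (at y)"
      unfolding derivative_coeffs_Suc(2)
      by (rule has_vector_derivative_cong_pos[OF exp_series_has_vector_derivative_y])
        (use Suc assms(1) in \<open>auto intro: subexponential_derivative_coeffs\<close>)
    then show ?case
      by (simp add: mixed_partial_def partial_y_def vector_derivative_at)
  qed
next
  case (Suc k)
  have "((\<lambda>t. mixed_partial k l u t y) has_vector_derivative
      exp_series (derivative_coeffs (Suc k) l f) x y) (at x)"
    unfolding derivative_coeffs_Suc(1)
    by (rule has_vector_derivative_cong_pos[OF exp_series_has_vector_derivative_x])
      (use Suc assms(1) in \<open>auto intro: subexponential_derivative_coeffs\<close>)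
  then show ?case
    by (simp add: mixed_partial_def partial_x_def vector_derivative_at)
qed

text \<open>The operator is a finite combination of convergent series, so it may be applied term by
  term, where it multiplies each coefficient by the product of the two symbols.\<close>

lemma exp_series_solves_pde:
  assumes f: "subexponential f" and u: "\<And>x y. x > 0 \<Longrightarrow> y > 0 \<Longrightarrow> u x y = exp_series f x y"
    and G: "\<And>x y. x > 0 \<Longrightarrow> y > 0 \<Longrightarrow> G x y = exp_series g x y"
    and g: "\<And>n m. n \<ge> 1 \<Longrightarrow> m \<ge> 1 \<Longrightarrow>
      g n m = symbol_poly N a (- of_nat n) * symbol_poly M b (- of_nat m) * f n m"
  shows "solves_pde N a M b G u"
  unfolding solves_pde_def
proof (intro allI impI conjI)
  fix x y :: real and k l :: nat assume xy: "x > 0" "y > 0"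
  note mp = mixed_partial_exp_series[OF f u]
  note f' = subexponential_derivative_coeffs[OF f]
  show "(\<lambda>t. mixed_partial 0 l u x t) differentiable at y"
    by (rule differentiableI_vector,
        rule has_vector_derivative_cong_pos[OF exp_series_has_vector_derivative_y[OF f']])
      (use xy mp in auto)
  show "(\<lambda>t. mixed_partial k l u t y) differentiable at x"
    by (rule differentiableI_vector,
        rule has_vector_derivative_cong_pos[OF exp_series_has_vector_derivative_x[OF f']])
      (use xy mp in auto)
  let ?P = "{1..} \<times> {1..} :: (nat \<times> nat) set"
  have "((\<lambda>p. \<Sum>k\<le>N. \<Sum>l\<le>M. a k * b l * exp_term (derivative_coeffs k l f) x y p) has_sum
      (\<Sum>k\<le>N. \<Sum>l\<le>M. a k * b l * exp_series (derivative_coeffs k l f) x y)) ?P"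
    unfolding exp_series_def
    by (intro has_sum_sum has_sum_cmult_right has_sum_infsum exp_term_summable f' xy)
  also have "?this \<longleftrightarrow> (exp_term g x y has_sum
      (\<Sum>k\<le>N. \<Sum>l\<le>M. a k * b l * exp_series (derivative_coeffs k l f) x y)) ?P"
  proof (rule has_sum_cong)
    fix p assume "p \<in> ?P"
    then obtain n m where p: "p = (n, m)" "n \<ge> 1" "m \<ge> 1" by auto
    \<comment> \<open>Multiplying out the two symbols gives the double sum over \<open>k\<close> and
      \<open>l\<close>.\<close>
    show "(\<Sum>k\<le>N. \<Sum>l\<le>M. a k * b l * exp_term (derivative_coeffs k l f) x y p) = exp_term g x y p"
      unfolding p exp_term_def prod.case g[OF p(2,3)] symbol_poly_def sum_product
        sum_distrib_right derivative_coeffs_def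
      by (simp add: sum_distrib_left mult_ac)
  qed
  finally show "(\<Sum>k\<le>N. \<Sum>l\<le>M. a k * b l * mixed_partial k l u x y) = G x y"
    using xy by (simp add: mp G exp_series_def infsumI)
qed

theorem theorem2:
  fixes N M :: nat
    and a b :: "nat \<Rightarrow> complex"
    and c :: "nat \<Rightarrow> nat \<Rightarrow> complex"
  assumes "\<And>n::nat. n \<ge> 1 \<Longrightarrow> symbol_poly N a (- of_nat n) \<noteq> 0"
    and "\<And>n::nat. n \<ge> 1 \<Longrightarrow> symbol_poly M b (- of_nat n) \<noteq> 0"
    and "lambert_convergent c"
  shows "lambert_convergent (coeff_S N a M b c) \<and>
         solves_pde N a M b (lambert_series c) (lambert_series (coeff_S N a M b c))"
proof
  let ?B = "coeff_B N a M b c" and ?S = "coeff_S N a M b c"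
  have B: "subexponential ?B"
    using assms by (intro subexponential_coeff_B lambert_convergent_imp_subexponential)
  then show S: "lambert_convergent ?S"
    by (intro subexponential_imp_lambert_convergent subexponential_coeff_S)
  show "solves_pde N a M b (lambert_series c) (lambert_series ?S)"
  proof (rule exp_series_solves_pde[OF B])
    fix x y :: real assume xy: "x > 0" "y > 0"
    show "lambert_series c x y = exp_series (divisor_sum c) x y"
      by (rule lambert_series_eq_exp_series) fact+
    have "lambert_series ?S x y = exp_series (divisor_sum ?S) x y"
      by (rule lambert_series_eq_exp_series) fact+
    \<comment> \<open>The series uses positive indices only, exactly where Moebius inversion
      identifies the two coefficient families.\<close>
    also have "\<dots> = exp_series ?B x y"
      unfolding exp_series_def
      by (rule infsum_cong) (auto simp: exp_term_def divisor_sum_coeff_S)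
    finally show "lambert_series ?S x y = exp_series ?B x y" .
  next
    fix n m :: nat assume "n \<ge> 1" "m \<ge> 1"
    with assms(1)[of n] assms(2)[of m]
    \<comment> \<open>The symbols do not vanish, so they cancel the denominator in
      \<open>coeff_B\<close>.\<close>
    show "divisor_sum c n m = symbol_poly N a (- of_nat n) * symbol_poly M b (- of_nat m) * ?B n m"
      by (simp add: coeff_B_def divisor_sum_def)
  qed
qed

end
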